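(* Let $(X,T)$ be a transitive and weakly mean equicontinuous topological dynamical system. Then $(X,T)$ is minimal if and only if $\operatorname{supp}(X,T)=X$.
   Context: A topological dynamical system $(X,T)$ consists of a nonempty compact metric space $X$ with metric $d$ and a continuous map $T:X\to X$. It is transitive if some point of $X$ has dense forward orbit, and minimal if every point has dense forward orbit. $S_n$ denotes the group of permutations of $\{1,\dots,n\}$. $(X,T)$ is weakly mean equicontinuous if for every $\varepsilon>0$ there is $\delta>0$ such that $d(x,y)<\delta$ implies $\limsup_{n\to\infty}\inf_{\sigma\in S_n}\frac1n\sum_{k=1}^n d(T^kx,T^{\sigma(k)}y)<\varepsilon$. $M(X,T)$ is the set of $T$-invariant Borel probability measures on $X$; for $\mu\in M(X,T)$, $\operatorname{supp}(\mu)=\{x\in X:\mu(U)>0\text{ for every neighborhood }U\text{ of }x\}$; and $\operatorname{supp}(X,T)=\overline{\bigcup\{\operatorname{supp}(\mu):\mu\in M(X,T)\}}$. *)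

theory Defs
  imports "HOL-Probability.Probability"
begin

text \<open>
  The phase space is a set \<open>X\<close> in an ambient metric space, carrying the subspace metric and topology.
  Only the values of \<open>T\<close> on \<open>X\<close> matter.
\<close>

definition tds :: "'a::metric_space set \<Rightarrow> ('a \<Rightarrow> 'a) \<Rightarrow> bool" where
  "tds X T \<longleftrightarrow> X \<noteq> {} \<and> compact X \<and> continuous_on X T \<and> T \<in> X \<rightarrow> X"

definition forward_orbit :: "('a \<Rightarrow> 'a) \<Rightarrow> 'a \<Rightarrow> 'a set" where
  "forward_orbit T x = {(T ^^ n) x | n. True}"

definition transitive_tds :: "'a::metric_space set \<Rightarrow> ('a \<Rightarrow> 'a) \<Rightarrow> bool" where
  "transitive_tds X T \<longleftrightarrow> (\<exists>x\<in>X. X \<subseteq> closure (forward_orbit T x))"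

definition minimal_tds :: "'a::metric_space set \<Rightarrow> ('a \<Rightarrow> 'a) \<Rightarrow> bool" where
  "minimal_tds X T \<longleftrightarrow> (\<forall>x\<in>X. X \<subseteq> closure (forward_orbit T x))"

text \<open>The limsup is taken in the extended reals, since on type \<^typ>\<open>real\<close> it is not total.\<close>

definition weakly_mean_equicontinuous :: "'a::metric_space set \<Rightarrow> ('a \<Rightarrow> 'a) \<Rightarrow> bool" where
  "weakly_mean_equicontinuous X T \<longleftrightarrow>
    (\<forall>\<epsilon>>0. \<exists>\<delta>>0. \<forall>x\<in>X. \<forall>y\<in>X. dist x y < \<delta> \<longrightarrow>
      limsup (\<lambda>n. ereal (INF \<sigma>\<in>{\<sigma>. \<sigma> permutes {1..n}}.
        (1 / real n) * (\<Sum>k=1..n. dist ((T ^^ k) x) ((T ^^ \<sigma> k) y)))) < ereal \<epsilon>)"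

text \<open>
  A measure here has \<open>X\<close> as its underlying space. If \<open>T\<close> is continuous on \<open>X\<close> and maps \<open>X\<close> to itself,
  it is measurable for \<open>\<mu>\<close>, so \<^term>\<open>distr \<mu> \<mu> T\<close> is the genuine image measure.
\<close>

definition invariant_measures :: "'a::metric_space set \<Rightarrow> ('a \<Rightarrow> 'a) \<Rightarrow> 'a measure set" where
  "invariant_measures X T =
    {\<mu>. sets \<mu> = sets (restrict_space borel X) \<and> prob_space \<mu> \<and> distr \<mu> \<mu> T = \<mu>}"

text \<open>
  Quantifying over open neighborhoods (relative to \<open>X\<close>) suffices by monotonicity, and avoids
  non-measurable neighborhoods, to which \<^const>\<open>emeasure\<close> assigns the value 0.
\<close>

definition measure_support :: "'a::metric_space set \<Rightarrow> 'a measure \<Rightarrow> 'a set" where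
  "measure_support X \<mu> =
    {x \<in> X. \<forall>U. openin (top_of_set X) U \<and> x \<in> U \<longrightarrow> emeasure \<mu> U > 0}"

definition tds_support :: "'a::metric_space set \<Rightarrow> ('a \<Rightarrow> 'a) \<Rightarrow> 'a set" where
  "tds_support X T = closure (\<Union>\<mu>\<in>invariant_measures X T. measure_support X \<mu>)"

end

theory Submission
  imports Defs
begin

text \<open>
  Write \<open>A\<^sub>n f x\<close> for the average of \<open>f\<close> over \<open>T x, \<dots>, T\<^sup>n x\<close>. Reordering the orbit segment of \<open>y\<close> does not
  change \<open>A\<^sub>n f y\<close>, so for a 1-Lipschitz \<open>f\<close> the difference \<open>\<bar>A\<^sub>n f x - A\<^sub>n f y\<bar>\<close> is at most the optimal
  matching cost of the two segments, which is the quantity controlled by weak mean equicontinuity.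
  A transitive point has iterates arbitrarily close to any \<open>y\<close>, and averages along an orbit forget
  the starting index; hence \<open>A\<^sub>n f\<close> has the same asymptotic behaviour at all points
  (\<open>orbit_average_diff_tendsto_0\<close>).

  \<^emph>\<open>Full support gives minimality.\<close> If the orbit closure \<open>Y\<close> of \<open>z\<close> is a proper subset of \<open>X\<close>, take for
  \<open>f\<close> the distance to \<open>Y\<close>. Its averages vanish at \<open>z\<close>, so they tend to 0 everywhere, and integrating
  against an invariant measure gives \<open>\<integral>f d\<mu> = 0\<close> (\<open>AE_eq_0_if_orbit_averages_vanish\<close>). The nonempty open set
  \<open>X - Y\<close> is then null for every invariant measure, which contradicts full support.

  \<^emph>\<open>Minimality gives full support.\<close> Every nonempty open set is visited by every orbit, so its preimages
  under the iterates of \<open>T\<close> cover \<open>X\<close> and it has positive measure for every invariant \<open>\<mu>\<close>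
  (\<open>full_support_if_minimal\<close>). What remains is that an invariant measure exists, the theorem of Krylov and
  Bogolyubov (\<open>invariant_measures_nonempty\<close>). The proof given here avoids weak limits of measures: by
  Tychonoff, the visiting frequencies of \<^emph>\<open>all\<close> subsets of \<open>X\<close> converge along one common filter finer than
  \<open>sequentially\<close>, and the limit is a finitely additive \<open>T\<close>-invariant mean on all subsets
  (\<open>exists_invariant_mean\<close>). Restricted to compact sets it is a content, and a content on compact
  sets induces a Borel measure by Caratheodory's construction (\<open>content_induces_measure\<close>). The
  measure of an open set is an inner supremum over compact sets, whose images and preimages under \<open>T\<close>
  are again compact, so invariance carries over from the mean to the measure.
\<close>

section \<open>Orbit averages and weak mean equicontinuity\<close>

definition orbit_average :: "('a \<Rightarrow> 'a) \<Rightarrow> ('a \<Rightarrow> real) \<Rightarrow> nat \<Rightarrow> 'a \<Rightarrow> real" where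
  "orbit_average T f n x = (1 / real n) * (\<Sum>k=1..n. f ((T ^^ k) x))"

lemma funpow_in_invariant_set:
  assumes "T \<in> X \<rightarrow> X" "x \<in> X" shows "(T ^^ k) x \<in> X"
  using assms by (induction k) auto

text \<open>
  For each permutation, the orbit segment of \<open>y\<close> may be summed in permuted order, and then the two
  segments are compared term by term.
\<close>

lemma orbit_average_diff_le_matching:
  fixes T :: "'a::metric_space \<Rightarrow> 'a" and f :: "'a \<Rightarrow> real"
  assumes lip: "\<And>u v. \<bar>f u - f v\<bar> \<le> dist u v"
  shows "\<bar>orbit_average T f n x - orbit_average T f n y\<bar>
    \<le> (INF \<sigma>\<in>{\<sigma>. \<sigma> permutes {1..n}}.
        (1 / real n) * (\<Sum>k=1..n. dist ((T ^^ k) x) ((T ^^ \<sigma> k) y)))"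
proof (rule cINF_greatest)
  show "{\<sigma>. \<sigma> permutes {1..n}} \<noteq> {}"
    using permutes_id by blast
next
  fix \<sigma> assume "\<sigma> \<in> {\<sigma>. \<sigma> permutes {1..n}}"
  then have \<sigma>: "\<sigma> permutes {1..n}" by simp
  have "(\<Sum>k=1..n. f ((T ^^ k) y)) = (\<Sum>k=1..n. f ((T ^^ \<sigma> k) y))"
    using sum.permute[OF \<sigma>, of "\<lambda>k. f ((T ^^ k) y)"] by (simp add: o_def)
  then have "orbit_average T f n x - orbit_average T f n y
      = (1 / real n) * (\<Sum>k=1..n. f ((T ^^ k) x) - f ((T ^^ \<sigma> k) y))"
    by (simp add: orbit_average_def sum_subtractf right_diff_distrib)
  then have "\<bar>orbit_average T f n x - orbit_average T f n y\<bar>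
      = (1 / real n) * \<bar>\<Sum>k=1..n. f ((T ^^ k) x) - f ((T ^^ \<sigma> k) y)\<bar>"
    by (simp add: abs_mult)
  also have "\<dots> \<le> (1 / real n) * (\<Sum>k=1..n. dist ((T ^^ k) x) ((T ^^ \<sigma> k) y))"
    by (intro mult_left_mono order.trans[OF sum_abs] sum_mono lip) auto
  finally show "\<bar>orbit_average T f n x - orbit_average T f n y\<bar>
      \<le> (1 / real n) * (\<Sum>k=1..n. dist ((T ^^ k) x) ((T ^^ \<sigma> k) y))" .
qed

text \<open>Shifting the orbit by one step telescopes: only the two end terms survive the division by \<open>n\<close>.\<close>

lemma orbit_average_image_diff_tendsto_0:
  assumes bnd: "\<And>k. \<bar>f ((T ^^ k) x)\<bar> \<le> B"
  shows "(\<lambda>n. orbit_average T f n (T x) - orbit_average T f n x) \<longlonglongrightarrow> 0"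
proof (rule Lim_null_comparison)
  show "\<forall>\<^sub>F n in sequentially. norm (orbit_average T f n (T x) - orbit_average T f n x)
      \<le> 2 * B / real n"
  proof (intro always_eventually allI)
    fix n
    have "orbit_average T f n (T x) - orbit_average T f n x
        = (1 / real n) * (\<Sum>k=1..n. f ((T ^^ Suc k) x) - f ((T ^^ k) x))"
      by (simp add: orbit_average_def sum_subtractf right_diff_distrib funpow_swap1)
    also have "(\<Sum>k=1..n. f ((T ^^ Suc k) x) - f ((T ^^ k) x)) = f ((T ^^ Suc n) x) - f ((T ^^ 1) x)"
      by (induction n) auto
    finally have "\<bar>orbit_average T f n (T x) - orbit_average T f n x\<bar>
        = (1 / real n) * \<bar>f ((T ^^ Suc n) x) - f ((T ^^ 1) x)\<bar>"
      by (simp add: abs_mult)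
    also have "\<dots> \<le> (1 / real n) * (2 * B)"
      using bnd[of "Suc n"] bnd[of 1] by (intro mult_left_mono) (linarith, simp)
    finally show "norm (orbit_average T f n (T x) - orbit_average T f n x) \<le> 2 * B / real n"
      by simp
  qed
  show "(\<lambda>n. 2 * B / real n) \<longlonglongrightarrow> 0"
    by (rule lim_const_over_n)
qed

lemma orbit_average_funpow_diff_tendsto_0:
  assumes bnd: "\<And>k. \<bar>f ((T ^^ k) x)\<bar> \<le> B"
  shows "(\<lambda>n. orbit_average T f n ((T ^^ m) x) - orbit_average T f n x) \<longlonglongrightarrow> 0"
proof (induction m)
  case (Suc m)
  have "(\<lambda>n. orbit_average T f n (T ((T ^^ m) x)) - orbit_average T f n ((T ^^ m) x)) \<longlonglongrightarrow> 0"
  proof (rule orbit_average_image_diff_tendsto_0)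
    show "\<bar>f ((T ^^ k) ((T ^^ m) x))\<bar> \<le> B" for k
      using bnd[of "k + m"] by (simp add: funpow_add)
  qed
  from tendsto_add[OF this Suc] show ?case by simp
qed simp

text \<open>
  Compare \<open>y\<close> with an iterate of the transitive point \<open>z\<close> that lies within \<open>\<delta>\<close> of \<open>y\<close>; passing from this iterate
  to \<open>z\<close> itself costs nothing in the limit.
\<close>

lemma orbit_average_diff_tendsto_0:
  fixes X :: "'a::metric_space set" and f :: "'a \<Rightarrow> real"
  assumes tds: "tds X T" and wme: "weakly_mean_equicontinuous X T"
    and z: "z \<in> X" and dense: "X \<subseteq> closure (forward_orbit T z)"
    and lip: "\<And>u v. \<bar>f u - f v\<bar> \<le> dist u v"
    and y: "y \<in> X"
  shows "(\<lambda>n. orbit_average T f n y - orbit_average T f n z) \<longlonglongrightarrow> 0"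
proof (rule tendstoI)
  fix e :: real assume "e > 0"
  have TX: "T \<in> X \<rightarrow> X" and "compact X"
    using tds by (auto simp: tds_def)
  from \<open>e > 0\<close> wme obtain \<delta> where "\<delta> > 0" and \<delta>:
    "\<And>x y. x \<in> X \<Longrightarrow> y \<in> X \<Longrightarrow> dist x y < \<delta> \<Longrightarrow>
      limsup (\<lambda>n. ereal (INF \<sigma>\<in>{\<sigma>. \<sigma> permutes {1..n}}.
        (1 / real n) * (\<Sum>k=1..n. dist ((T ^^ k) x) ((T ^^ \<sigma> k) y)))) < ereal (e / 2)"
    unfolding weakly_mean_equicontinuous_def by (meson half_gt_zero)
  from dense y have "y \<in> closure (forward_orbit T z)" by blast
  with \<open>\<delta> > 0\<close> obtain m where m: "dist ((T ^^ m) z) y < \<delta>"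
    by (auto simp: closure_approachable forward_orbit_def)
  let ?x = "(T ^^ m) z"
  have "?x \<in> X" by (rule funpow_in_invariant_set[OF TX z])
  from Limsup_lessD[OF \<delta>[OF this y m]]
  have near: "\<forall>\<^sub>F n in sequentially. \<bar>orbit_average T f n ?x - orbit_average T f n y\<bar> < e / 2"
    by (rule eventually_mono) (rule le_less_trans[OF orbit_average_diff_le_matching[OF lip]], simp only: less_ereal.simps)
  obtain B where B: "\<And>u v. u \<in> X \<Longrightarrow> v \<in> X \<Longrightarrow> dist u v \<le> B"
    using compact_imp_bounded[OF \<open>compact X\<close>] by (metis diameter_bounded_bound)
  have bnd: "\<bar>f ((T ^^ k) z)\<bar> \<le> \<bar>f z\<bar> + B" for k
    using lip[of "(T ^^ k) z" z] B[OF funpow_in_invariant_set[OF TX z] z, of k] by linarith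
  from tendstoD[OF orbit_average_funpow_diff_tendsto_0[of f T z, OF bnd, of m], of "e / 2"] \<open>e > 0\<close>
  have "\<forall>\<^sub>F n in sequentially. \<bar>orbit_average T f n ?x - orbit_average T f n z\<bar> < e / 2"
    by (simp add: dist_real_def)
  with near show "\<forall>\<^sub>F n in sequentially. dist (orbit_average T f n y - orbit_average T f n z) 0 < e"
    by eventually_elim (simp only: dist_real_def; linarith)
qed

section \<open>Invariant measures and the two implications\<close>

lemma tds_map_measurable:
  assumes tds: "tds X T" and \<mu>: "sets \<mu> = sets (restrict_space borel X)"
  shows "T \<in> measurable \<mu> \<mu>"
proof -
  have "T \<in> borel_measurable (restrict_space borel X)"
    using tds by (auto simp: tds_def intro: borel_measurable_continuous_on_restrict)
  then have "T \<in> measurable (restrict_space borel X) (restrict_space borel X)"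
    using tds by (intro measurable_restrict_space2) (auto simp: tds_def space_restrict_space)
  then show ?thesis
    using measurable_cong_sets[OF \<mu> \<mu>] by blast
qed

lemma invariant_measuresD:
  assumes tds: "tds X T" and \<mu>: "\<mu> \<in> invariant_measures X T"
  shows "sets \<mu> = sets (restrict_space borel X)" "space \<mu> = X" "prob_space \<mu>"
    "T \<in> measurable \<mu> \<mu>" "distr \<mu> \<mu> T = \<mu>"
proof -
  show s: "sets \<mu> = sets (restrict_space borel X)" and "prob_space \<mu>" "distr \<mu> \<mu> T = \<mu>"
    using \<mu> by (auto simp: invariant_measures_def)
  from sets_eq_imp_space_eq[OF s] show "space \<mu> = X"
    by (simp add: space_restrict_space)
  show "T \<in> measurable \<mu> \<mu>"
    by (rule tds_map_measurable[OF tds s])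
qed

lemma
  assumes T: "T \<in> measurable \<mu> \<mu>" and inv: "distr \<mu> \<mu> T = \<mu>"
  shows measurable_funpow: "T ^^ k \<in> measurable \<mu> \<mu>" 
    and distr_funpow_invariant: "distr \<mu> \<mu> (T ^^ k) = \<mu>"
proof (induction k)
  case 0
  { case 1 show ?case by simp }
  { case 2 show ?case by (simp add: distr_id[unfolded id_def] id_def) }
next
  case (Suc k)
  { case 1 show ?case using Suc(1) T by (simp add: measurable_comp) }
  { case 2 show ?case using distr_distr[OF T Suc(1)] Suc(2) inv by (simp add: o_def) }
qed

lemma integral_orbit_average:
  fixes f :: "'a \<Rightarrow> real"
  assumes T: "T \<in> measurable \<mu> \<mu>" and inv: "distr \<mu> \<mu> T = \<mu>" and f: "integrable \<mu> f" and "n > 0"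
  shows "(\<integral>x. orbit_average T f n x \<partial>\<mu>) = (\<integral>x. f x \<partial>\<mu>)"
proof -
  note Tk = measurable_funpow[OF T inv] and Dk = distr_funpow_invariant[OF T inv]
  have int: "integrable \<mu> (\<lambda>x. f ((T ^^ k) x))" for k
    using integrable_distr[OF Tk[of k], of f] f by (simp add: Dk)
  have eq: "(\<integral>x. f ((T ^^ k) x) \<partial>\<mu>) = (\<integral>x. f x \<partial>\<mu>)" for k
    using integral_distr[OF Tk[of k], of f] f by (simp add: Dk)
  show ?thesis
    using \<open>n > 0\<close> by (simp add: orbit_average_def int eq Bochner_Integration.integral_sum)
qed

text \<open>
  By invariance every average \<open>A\<^sub>n f\<close> has the same integral as \<open>f\<close>, and by dominated convergence these
  integrals tend to 0; a nonnegative function with integral 0 vanishes almost everywhere.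
\<close>

lemma AE_eq_0_if_orbit_averages_vanish:
  fixes f :: "'a::metric_space \<Rightarrow> real"
  assumes tds: "tds X T" and \<mu>: "\<mu> \<in> invariant_measures X T"
    and cont: "continuous_on X f" and nonneg: "\<And>x. x \<in> X \<Longrightarrow> 0 \<le> f x"
    and lim: "\<And>x. x \<in> X \<Longrightarrow> (\<lambda>n. orbit_average T f n x) \<longlonglongrightarrow> 0"
  shows "AE x in \<mu>. f x = 0"
proof -
  note \<mu>D = invariant_measuresD[OF tds \<mu>]
  interpret prob_space \<mu> by (rule \<mu>D(3))
  have TX: "T \<in> X \<rightarrow> X" and "compact X"
    using tds by (auto simp: tds_def)
  have meas: "f \<in> borel_measurable \<mu>"
    using borel_measurable_continuous_on_restrict[OF cont] measurable_cong_sets[OF \<mu>D(1) refl] by blast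
  have "bounded (f ` X)"
    using compact_continuous_image[OF cont \<open>compact X\<close>] by (rule compact_imp_bounded)
  then obtain B where B: "\<And>x. x \<in> X \<Longrightarrow> \<bar>f x\<bar> \<le> B"
    by (auto simp: bounded_iff)
  have int: "integrable \<mu> f"
    using meas B \<mu>D(2) by (intro integrable_const_bound[where B=B]) auto
  have "(\<lambda>n. \<integral>x. orbit_average T f n x \<partial>\<mu>) \<longlonglongrightarrow> (\<integral>x. 0 \<partial>\<mu>)"
  proof (rule integral_dominated_convergence[where w="\<lambda>_. B"])
    show "orbit_average T f n \<in> borel_measurable \<mu>" for n
      unfolding orbit_average_def using measurable_compose[OF measurable_funpow[OF \<mu>D(4,5)] meas] by measurable
    show "AE x in \<mu>. norm (orbit_average T f n x) \<le> B" for n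
    proof (rule AE_I2)
      fix x assume "x \<in> space \<mu>"
      then have x: "x \<in> X" by (simp add: \<mu>D)
      have "B \<ge> 0" using B[OF x] by linarith
      have "\<bar>orbit_average T f n x\<bar> \<le> (1 / real n) * (\<Sum>k=1..n. B)"
        unfolding orbit_average_def abs_mult
        by (intro mult_mono order.trans[OF sum_abs] sum_mono B funpow_in_invariant_set[OF TX x]) auto
      also have "\<dots> \<le> B" using \<open>B \<ge> 0\<close> by simp
      finally show "norm (orbit_average T f n x) \<le> B" by simp
    qed
    show "AE x in \<mu>. (\<lambda>n. orbit_average T f n x) \<longlonglongrightarrow> 0"
      using lim \<mu>D(2) by auto
  qed auto
  moreover have "(\<lambda>n. \<integral>x. orbit_average T f n x \<partial>\<mu>) \<longlonglongrightarrow> (\<integral>x. f x \<partial>\<mu>)"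
    by (rule tendsto_eventually)
      (auto intro!: eventually_mono[OF eventually_gt_at_top[of 0]] integral_orbit_average[OF \<mu>D(4,5) int])
  ultimately have "(\<integral>x. f x \<partial>\<mu>) = 0"
    using LIMSEQ_unique by force
  then show ?thesis
    using integral_nonneg_eq_0_iff_AE[OF int] nonneg \<mu>D(2) by auto
qed

text \<open>
  The distance \<open>f\<close> to the orbit of \<open>z\<close> has zero averages at \<open>z\<close>, hence asymptotically zero averages at every
  point, so \<open>{f > 0}\<close> is null for all invariant measures. By full support it does not meet \<open>X\<close>, that is, the
  orbit of \<open>z\<close> is dense.
\<close>

lemma minimal_if_full_support:
  fixes X :: "'a::metric_space set"
  assumes tds: "tds X T" and trans: "transitive_tds X T" and wme: "weakly_mean_equicontinuous X T"
    and full: "tds_support X T = X"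
  shows "minimal_tds X T"
  unfolding minimal_tds_def
proof (intro ballI subsetI, rule ccontr)
  fix z w assume z: "z \<in> X" and w: "w \<in> X" and "w \<notin> closure (forward_orbit T z)"
  define f where "f x = infdist x (forward_orbit T z)" for x
  have orb: "(T ^^ k) z \<in> forward_orbit T z" for k
    by (auto simp: forward_orbit_def)
  have ne: "forward_orbit T z \<noteq> {}" using orb by blast
  have "f w > 0"
    using \<open>w \<notin> closure _\<close> ne infdist_nonneg[of w "forward_orbit T z"]
    by (simp add: f_def in_closure_iff_infdist_zero less_le)
  have lip: "\<bar>f u - f v\<bar> \<le> dist u v" for u v
    unfolding f_def by (rule infdist_triangle_abs)
  have contf: "continuous_on A f" for A
    unfolding f_def by (intro continuous_intros)
  have f_ge0: "f x \<ge> 0" for x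
    unfolding f_def by (rule infdist_nonneg)
  have f0: "f ((T ^^ k) z) = 0" for k
    using orb by (simp add: f_def)
  from trans obtain x0 where x0: "x0 \<in> X" "X \<subseteq> closure (forward_orbit T x0)"
    by (auto simp: transitive_tds_def)
  have lim: "(\<lambda>n. orbit_average T f n y) \<longlonglongrightarrow> 0" if "y \<in> X" for y
    using tendsto_diff[OF orbit_average_diff_tendsto_0[OF tds wme x0 lip that]
        orbit_average_diff_tendsto_0[OF tds wme x0 lip z]]
    by (simp add: orbit_average_def f0)
  let ?O = "{x. f x > 0}"
  have "open ?O"
    using open_Collect_less[OF continuous_on_const contf] by simp
  have null: "emeasure \<mu> (X \<inter> ?O) = 0" if \<mu>: "\<mu> \<in> invariant_measures X T" for \<mu>
  proof -
    have "AE x in \<mu>. f x = 0"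
      using lim contf f_ge0 by (intro AE_eq_0_if_orbit_averages_vanish[OF tds \<mu>]) auto
    then have "AE x in \<mu>. \<not> f x > 0" by eventually_elim simp
    moreover have "X \<inter> ?O \<in> sets \<mu>"
      using \<open>open ?O\<close> by (auto simp: invariant_measuresD[OF tds \<mu>] sets_restrict_space)
    ultimately show ?thesis
      by (subst AE_iff_measurable[symmetric, where P="\<lambda>x. \<not> f x > 0"])
        (auto simp: invariant_measuresD[OF tds \<mu>])
  qed
  have "w \<in> closure (\<Union>\<mu>\<in>invariant_measures X T. measure_support X \<mu>)"
    using w full by (simp add: tds_support_def)
  then obtain \<mu> x where \<mu>: "\<mu> \<in> invariant_measures X T" and x: "x \<in> measure_support X \<mu>" "f x > 0"
    using \<open>open ?O\<close> \<open>f w > 0\<close> open_Int_closure_eq_empty[OF \<open>open ?O\<close>] by blast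
  have "openin (top_of_set X) (X \<inter> ?O)" using \<open>open ?O\<close> by blast
  then have "emeasure \<mu> (X \<inter> ?O) > 0"
    using x unfolding measure_support_def by blast
  with null[OF \<mu>] show False by simp
qed

text \<open>
  A single invariant measure suffices: if \<open>U\<close> is open and nonempty, then minimality makes the preimages of \<open>U\<close>
  under the iterates of \<open>T\<close> cover \<open>X\<close>. They all have the measure of \<open>U\<close>, so \<open>U\<close> cannot be null.
\<close>

lemma full_support_if_minimal:
  fixes X :: "'a::metric_space set"
  assumes tds: "tds X T" and min: "minimal_tds X T" and ex: "invariant_measures X T \<noteq> {}"
  shows "tds_support X T = X"
proof (rule antisym)
  have "closed X" using tds by (auto simp: tds_def compact_imp_closed)
  then show "tds_support X T \<subseteq> X"
    unfolding tds_support_def by (intro closure_minimal) (auto simp: measure_support_def)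
next
  from ex obtain \<mu> where \<mu>: "\<mu> \<in> invariant_measures X T" by blast
  note \<mu>D = invariant_measuresD[OF tds \<mu>]
  interpret prob_space \<mu> by (rule \<mu>D(3))
  have "X \<subseteq> measure_support X \<mu>"
    unfolding measure_support_def
  proof (intro subsetI CollectI conjI allI impI; (elim conjE)?)
    fix x U assume U: "openin (top_of_set X) U" and "x \<in> U"
    from U obtain V where V: "open V" "U = X \<inter> V"
      by (auto simp: openin_open)
    have Us: "U \<in> sets \<mu>"
      using V by (auto simp: \<mu>D(1) sets_restrict_space)
    have "X \<subseteq> (\<Union>n. (T ^^ n) -` U \<inter> space \<mu>)"
    proof
      fix y assume y: "y \<in> X"
      with min \<open>x \<in> U\<close> V have "x \<in> closure (forward_orbit T y)" "x \<in> V"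
        by (auto simp: minimal_tds_def)
      then obtain n where "(T ^^ n) y \<in> V"
        using \<open>open V\<close> open_Int_closure_eq_empty[OF \<open>open V\<close>, of "forward_orbit T y"]
        by (auto simp: forward_orbit_def)
      moreover have "(T ^^ n) y \<in> X"
        using tds y by (intro funpow_in_invariant_set) (auto simp: tds_def)
      ultimately show "y \<in> (\<Union>n. (T ^^ n) -` U \<inter> space \<mu>)"
        using V y \<mu>D(2) by auto
    qed
    moreover have "emeasure \<mu> (\<Union>n. (T ^^ n) -` U \<inter> space \<mu>) = 0" if "emeasure \<mu> U = 0"
    proof (rule emeasure_UN_eq_0)
      fix n
      show "emeasure \<mu> ((T ^^ n) -` U \<inter> space \<mu>) = 0"
        using emeasure_distr[OF measurable_funpow[OF \<mu>D(4,5)] Us, of n] that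
        by (simp add: distr_funpow_invariant[OF \<mu>D(4,5)])
    qed (auto intro!: measurable_sets[OF measurable_funpow[OF \<mu>D(4,5)] Us])
    moreover have "(\<Union>n. (T ^^ n) -` U \<inter> space \<mu>) \<subseteq> X" by (auto simp: \<mu>D(2))
    ultimately show "emeasure \<mu> U > 0"
      using emeasure_space_1 \<mu>D(2) by (metis antisym not_gr_zero zero_neq_one)
  qed
  with \<mu> show "X \<subseteq> tds_support X T"
    unfolding tds_support_def by (blast intro: subsetD[OF closure_subset])
qed

section \<open>Measures from contents on compact sets\<close>

definition inner_content :: "('a::topological_space set \<Rightarrow> ennreal) \<Rightarrow> 'a set \<Rightarrow> ennreal" where
  "inner_content m U = (SUP K\<in>{K. compact K \<and> K \<subseteq> U}. m K)"

definition content_outer :: "('a::topological_space set \<Rightarrow> ennreal) \<Rightarrow> 'a set \<Rightarrow> ennreal" where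
  "content_outer m A = (INF U\<in>{U. open U \<and> A \<subseteq> U}. inner_content m U)"

lemma inner_content_mono: "U \<subseteq> V \<Longrightarrow> inner_content m U \<le> inner_content m V"
  unfolding inner_content_def by (rule SUP_subset_mono) auto

lemma content_le_inner_content: "compact K \<Longrightarrow> K \<subseteq> U \<Longrightarrow> m K \<le> inner_content m U"
  unfolding inner_content_def by (rule SUP_upper) auto

lemma content_outer_le: "open U \<Longrightarrow> A \<subseteq> U \<Longrightarrow> content_outer m A \<le> inner_content m U"
  unfolding content_outer_def by (rule INF_lower) auto

lemma content_outer_open: "open U \<Longrightarrow> content_outer m U = inner_content m U"
  unfolding content_outer_def by (intro antisym INF_lower INF_greatest) (auto intro: inner_content_mono)

lemma content_outer_mono: "A \<subseteq> B \<Longrightarrow> content_outer m A \<le> content_outer m B"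
  unfolding content_outer_def by (rule INF_superset_mono) auto

text \<open>
  These are the axioms of a content in the sense of Halmos, with \<open>\<infinity>\<close> allowed as a value.
\<close>

locale compact_content =
  fixes m :: "'a::metric_space set \<Rightarrow> ennreal"
  assumes content_empty: "m {} = 0"
    and content_mono: "compact K \<Longrightarrow> compact L \<Longrightarrow> K \<subseteq> L \<Longrightarrow> m K \<le> m L"
    and content_subadditive: "compact K \<Longrightarrow> compact L \<Longrightarrow> m (K \<union> L) \<le> m K + m L"
    and content_additive: "compact K \<Longrightarrow> compact L \<Longrightarrow> K \<inter> L = {} \<Longrightarrow> m (K \<union> L) = m K + m L"
begin

lemma content_finite_UN_le:
  assumes "finite I" "\<And>i. i \<in> I \<Longrightarrow> compact (K i)"
  shows "m (\<Union>i\<in>I. K i) \<le> (\<Sum>i\<in>I. m (K i))"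
  using assms
proof (induction I rule: finite_induct)
  case (insert i I)
  have "m (\<Union>i\<in>insert i I. K i) \<le> m (K i) + m (\<Union>i\<in>I. K i)"
    using content_subadditive[of "K i" "\<Union>i\<in>I. K i"] insert by (auto intro: compact_UN)
  also have "\<dots> \<le> m (K i) + (\<Sum>i\<in>I. m (K i))"
    using insert by (intro add_left_mono) auto
  finally show ?case using insert by simp
qed (simp add: content_empty)

text \<open>
  Countable subadditivity reduces to finite subadditivity by compactness: around each point of \<open>K\<close> some closed ball lies
  in a single \<open>U i\<close>, and finitely many of these balls cut \<open>K\<close> into compact pieces, each inside one \<open>U i\<close>.
\<close>

lemma content_le_suminf_inner_content:
  fixes U :: "nat \<Rightarrow> 'a set"
  assumes K: "compact K" and U: "\<And>i. open (U i)" and cover: "K \<subseteq> (\<Union>i. U i)"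
  shows "m K \<le> (\<Sum>i. inner_content m (U i))"
proof -
  have "\<forall>x\<in>K. \<exists>i r. r > 0 \<and> cball x r \<subseteq> U i"
    using cover U open_contains_cball by blast
  then obtain i r where r: "\<And>x. x \<in> K \<Longrightarrow> r x > 0" and i: "\<And>x. x \<in> K \<Longrightarrow> cball x (r x) \<subseteq> U (i x)"
    by metis
  have "K \<subseteq> (\<Union>x\<in>K. ball x (r x))" using r by force
  then obtain D where D: "D \<subseteq> K" "finite D" "K \<subseteq> (\<Union>x\<in>D. ball x (r x))"
    using compactE_image[OF K, of K "\<lambda>x. ball x (r x)"] by auto
  define L where "L j = (\<Union>x\<in>{x\<in>D. i x = j}. K \<inter> cball x (r x))" for j
  have L: "compact (L j)" "L j \<subseteq> U j" for j
    unfolding L_def using D i K by (auto intro!: compact_UN compact_Int_closed)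
  have "K = (\<Union>j\<in>i ` D. L j)"
    using D(3) by (fastforce simp: L_def)
  then have "m K \<le> (\<Sum>j\<in>i ` D. m (L j))"
    using content_finite_UN_le[of "i ` D" L] L D(2) by simp
  also have "\<dots> \<le> (\<Sum>j\<in>i ` D. inner_content m (U j))"
    by (intro sum_mono content_le_inner_content L)
  also have "\<dots> \<le> (\<Sum>j. inner_content m (U j))"
    using D(2) by (intro sum_le_suminf) auto
  finally show ?thesis .
qed

lemma inner_content_UN_le:
  fixes U :: "nat \<Rightarrow> 'a set"
  assumes "\<And>i. open (U i)"
  shows "inner_content m (\<Union>i. U i) \<le> (\<Sum>i. inner_content m (U i))"
  unfolding inner_content_def[of _ "\<Union>i. U i"]
  by (intro SUP_least content_le_suminf_inner_content assms) auto

lemma outer_measure_space_content_outer: "outer_measure_space UNIV (content_outer m)"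
  unfolding outer_measure_space_def
proof (intro conjI)
  show "positive UNIV (content_outer m)"
    by (simp add: positive_def content_outer_open inner_content_def content_empty)
  show "increasing UNIV (content_outer m)"
    by (simp add: increasing_def content_outer_mono)
  show "countably_subadditive UNIV (content_outer m)"
    unfolding countably_subadditive_def
  proof (intro allI impI)
    fix A :: "nat \<Rightarrow> 'a set"
    show "content_outer m (\<Union>i. A i) \<le> (\<Sum>i. content_outer m (A i))"
    proof (rule ennreal_le_epsilon)
      fix e :: real assume "0 < e" "(\<Sum>n. content_outer m (A n)) < top"
      then have *: "\<And>n. content_outer m (A n) < content_outer m (A n) + e * (1/2)^Suc n"
        by (auto simp add: less_top dest!: ennreal_suminf_lessD)
      then have "\<exists>U. open U \<and> A n \<subseteq> U \<and> inner_content m U < content_outer m (A n) + e * (1/2)^Suc n" for n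
        using *[of n] unfolding content_outer_def INF_less_iff by blast
      then obtain U where U: "\<And>n. open (U n)" "\<And>n. A n \<subseteq> U n"
        and le: "\<And>n. inner_content m (U n) \<le> content_outer m (A n) + e * (1/2)^Suc n"
        by (metis less_imp_le)
      \<comment> \<open>The errors \<open>e / 2, e / 4, \<dots>\<close> of the open approximations add up to \<open>e\<close>.\<close>
      have "content_outer m (\<Union>i. A i) \<le> inner_content m (\<Union>i. U i)"
        using U by (intro content_outer_le) auto
      also have "\<dots> \<le> (\<Sum>n. inner_content m (U n))"
        by (intro inner_content_UN_le U)
      also have "\<dots> \<le> (\<Sum>n. content_outer m (A n) + e * (1/2) ^ Suc n)"
        by (intro suminf_le le) auto
      also have "\<dots> = (\<Sum>n. content_outer m (A n)) + (\<Sum>n. ennreal e * ennreal ((1/2) ^ Suc n))"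
        using \<open>0 < e\<close> by (subst suminf_add[symmetric])
                         (auto simp del: ennreal_suminf_cmult simp add: ennreal_mult[symmetric])
      also have "\<dots> = (\<Sum>n. content_outer m (A n)) + e"
        unfolding ennreal_suminf_cmult
        by (subst suminf_ennreal_eq[OF zero_le_power power_half_series]) auto
      finally show "content_outer m (\<Union>i. A i) \<le> (\<Sum>n. content_outer m (A n)) + e" .
    qed
  qed
qed

text \<open>
  This inequality makes open sets Caratheodory measurable. A compact \<open>K\<close> that almost exhausts \<open>V \<inter> U\<close> leaves the open
  set \<open>V - K\<close>, which covers \<open>V - U\<close>; compact subsets of \<open>V - K\<close> are disjoint from \<open>K\<close>, so that the content adds up.
\<close>

lemma inner_content_split:
  assumes V: "open V" and U: "open U"
  shows "inner_content m (V \<inter> U) + content_outer m (V - U) \<le> inner_content m V"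
proof -
  let ?c = "content_outer m (V - U)"
  have "m K + ?c \<le> inner_content m V" if K: "compact K" "K \<subseteq> V \<inter> U" for K
  proof -
    have "?c \<le> inner_content m (V - K)"
      using K V by (intro content_outer_le) (auto intro: open_Diff compact_imp_closed)
    then have "m K + ?c \<le> inner_content m (V - K) + m K"
      by (simp add: add.commute add_left_mono)
    also have "\<dots> = (SUP L\<in>{L. compact L \<and> L \<subseteq> V - K}. m L + m K)"
      unfolding inner_content_def by (rule ennreal_SUP_add_left[symmetric]) auto
    also have "\<dots> \<le> inner_content m V"
    proof (rule SUP_least)
      fix L assume "L \<in> {L. compact L \<and> L \<subseteq> V - K}"
      then have L: "compact L" "L \<subseteq> V" "L \<inter> K = {}" by auto
      then have "m L + m K = m (L \<union> K)" using K by (simp add: content_additive)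
      also have "\<dots> \<le> inner_content m V"
        using L K by (intro content_le_inner_content) auto
      finally show "m L + m K \<le> inner_content m V" .
    qed
    finally show ?thesis .
  qed
  then have "(SUP K\<in>{K. compact K \<and> K \<subseteq> V \<inter> U}. m K + ?c) \<le> inner_content m V"
    by (intro SUP_least) auto
  then show ?thesis
    unfolding inner_content_def[of _ "V \<inter> U"] by (subst ennreal_SUP_add_left[symmetric]) auto
qed

text \<open>
  The outer measure is already known on open sets, and Caratheodory's condition holds for each of them, so its
  restriction to the Borel sets is a measure.
\<close>

theorem content_induces_measure:
  obtains M where "sets M = sets borel" "\<And>U. open U \<Longrightarrow> emeasure M U = inner_content m U"
    "\<And>A. A \<in> sets borel \<Longrightarrow> emeasure M A = (INF U\<in>{U. open U \<and> A \<subseteq> U}. inner_content m U)"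
proof -
  let ?f = "content_outer m"
  let ?L = "lambda_system UNIV UNIV ?f"
  interpret P: sigma_algebra UNIV "UNIV :: 'a set set"
    using sigma_algebra_Pow[of "UNIV :: 'a set"] by simp
  have "measure_space UNIV ?L ?f"
    by (rule P.caratheodory_lemma[OF outer_measure_space_content_outer])
  moreover have "U \<in> ?L" if U: "open U" for U
    unfolding P.lambda_system_eq
  proof (intro CollectI conjI ballI antisym UNIV_I)
    fix A
    have "subadditive UNIV ?f"
      using outer_measure_space_content_outer unfolding outer_measure_space_def
      by (intro P.countably_subadditive_subadditive) auto
    then have "?f ((A \<inter> U) \<union> (A - U)) \<le> ?f (A \<inter> U) + ?f (A - U)"
      by (rule subadditiveD) auto
    moreover have "(A \<inter> U) \<union> (A - U) = A" by blast
    ultimately show "?f A \<le> ?f (A \<inter> U) + ?f (A - U)" by simp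
    show "?f (A \<inter> U) + ?f (A - U) \<le> ?f A"
      unfolding content_outer_def[of _ A]
    proof (rule INF_greatest)
      fix V assume "V \<in> {V. open V \<and> A \<subseteq> V}"
      then have V: "open V" "A \<subseteq> V" by auto
      have "?f (A \<inter> U) + ?f (A - U) \<le> inner_content m (V \<inter> U) + ?f (V - U)"
        using V U by (intro add_mono content_outer_le content_outer_mono) auto
      also have "\<dots> \<le> inner_content m V" by (rule inner_content_split[OF V(1) U])
      finally show "?f (A \<inter> U) + ?f (A - U) \<le> inner_content m V" .
    qed
  qed
  ultimately have "sigma_sets UNIV {S. open S} \<subseteq> ?L"
    unfolding measure_space_def by (intro sigma_algebra.sigma_sets_subset[of UNIV ?L]) auto
  then have "sets borel \<subseteq> ?L" by (simp add: borel_def)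
  then have ms: "measure_space UNIV (sets borel) ?f"
    by (rule measure_down[OF \<open>measure_space UNIV ?L ?f\<close> sets.sigma_algebra_axioms[of borel, unfolded space_borel]])
  define M where "M = measure_of UNIV (sets borel) ?f"
  have sM: "sets M = sets borel"
    unfolding M_def by (metis sets.sets_measure_of_eq space_borel)
  have eM: "emeasure M A = ?f A" if "A \<in> sets borel" for A
    using ms that sM unfolding measure_space_def
    by (intro emeasure_measure_of[OF M_def]) auto
  show thesis
  proof (rule that[of M])
    show "emeasure M U = inner_content m U" if "open U" for U
      using that by (simp add: eM content_outer_open)
    show "emeasure M A = (INF U\<in>{U. open U \<and> A \<subseteq> U}. inner_content m U)" if "A \<in> sets borel" for A
      using that by (simp add: eM content_outer_def)
  qed (rule sM)
qed

end

section \<open>Existence of an invariant measure\<close>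

text \<open>
  The sequence \<open>n \<mapsto> (g i n)\<^sub>i\<close> lives in a product of compact sets. A cluster point \<open>L\<close> exists by Tychonoff, but since
  the index set may be uncountable it need not be the limit of a subsequence; the filter \<open>G\<close> replaces it.
\<close>

lemma convergent_subfilter_of_compact_valued_family:
  fixes g :: "'i \<Rightarrow> nat \<Rightarrow> 'b::topological_space"
  assumes K: "\<And>i. compact (K i)" and g: "\<And>i n. g i n \<in> K i"
  obtains G L where "G \<noteq> bot" "G \<le> sequentially" "\<And>i. (g i \<longlongrightarrow> L i) G"
proof -
  have "compactin (product_topology (\<lambda>i. euclidean) UNIV) (PiE UNIV K)"
    using K by (simp add: compactin_PiE)
  then have comp: "compact (PiE UNIV K)"
    by (simp add: euclidean_product_topology)
  define h where "h n = (\<lambda>i. g i n)" for n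
  have "eventually (\<lambda>x. x \<in> PiE UNIV K) (filtermap h sequentially)"
    using g by (simp add: eventually_filtermap h_def PiE_UNIV_domain)
  moreover have "filtermap h sequentially \<noteq> bot"
    by (simp add: filtermap_bot_iff)
  ultimately obtain L where L: "inf (nhds L) (filtermap h sequentially) \<noteq> bot"
    using comp unfolding compact_filter by blast
  define G where "G = inf (filtercomap h (nhds L)) sequentially"
  have "G \<noteq> bot"
  proof
    assume "G = bot"
    then have "eventually (\<lambda>_. False) (inf (filtercomap h (nhds L)) sequentially)"
      by (simp add: G_def)
    then obtain P Q where PQ: "eventually P (nhds L)" "eventually Q sequentially" "\<And>n. P (h n) \<Longrightarrow> \<not> Q n"
      unfolding eventually_inf eventually_filtercomap by blast
    have "eventually (\<lambda>x. \<not> P x) (filtermap h sequentially)"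
      unfolding eventually_filtermap by (rule eventually_mono[OF PQ(2)]) (use PQ(3) in blast)
    with PQ(1) have "eventually (\<lambda>_. False) (inf (nhds L) (filtermap h sequentially))"
      unfolding eventually_inf by blast
    with L show False by (simp add: trivial_limit_def)
  qed
  moreover have "(h \<longlongrightarrow> L) G"
    unfolding G_def by (rule filterlim_mono[OF filterlim_filtercomap order.refl inf_le1])
  then have "(g i \<longlongrightarrow> L i) G" for i
    using continuous_on_tendsto_compose[OF continuous_on_product_coordinates, of h L G i]
    by (simp add: h_def)
  ultimately show thesis
    using that[of G L] by (simp add: G_def)
qed

lemma orbit_average_indicator_bounds:
  "orbit_average T (indicat_real A) n x \<in> {0..1}"
proof -
  have "(\<Sum>k=1..n. indicat_real A ((T ^^ k) x)) \<le> (\<Sum>k=1..n. 1)"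
    by (intro sum_mono) (auto simp: indicator_def)
  then have "orbit_average T (indicat_real A) n x \<le> (1 / real n) * (\<Sum>k=1..n. 1)"
    unfolding orbit_average_def by (intro mult_left_mono) auto
  also have "\<dots> \<le> 1" by simp
  finally show ?thesis by (simp add: orbit_average_def sum_nonneg)
qed

text \<open>
  The value \<open>p A\<close> is a generalized limit of the frequency with which the orbit of \<open>x\<close> visits \<open>A\<close>. Each property holds for
  the frequencies, up to an error that tends to 0 in the case of invariance, and passes to the limit. The orbit stays
  in \<open>X\<close>, so \<open>p\<close> sees only the part of a set that lies in \<open>X\<close>.
\<close>

lemma exists_invariant_mean:
  fixes T :: "'a \<Rightarrow> 'a"
  assumes TX: "T \<in> X \<rightarrow> X" and x: "x \<in> X"
  obtains p :: "'a set \<Rightarrow> real" where "\<And>A. 0 \<le> p A" "p {} = 0" "p X = 1"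
    "\<And>A B. A \<subseteq> B \<Longrightarrow> p A \<le> p B"
    "\<And>A B. p (A \<union> B) \<le> p A + p B"
    "\<And>A B. A \<inter> B = {} \<Longrightarrow> p (A \<union> B) = p A + p B"
    "\<And>A. p (X \<inter> A) = p A" "\<And>A. p (T -` A) = p A"
proof -
  let ?a = "\<lambda>A n. orbit_average T (indicat_real A) n x"
  obtain G p where G: "G \<noteq> bot" "G \<le> sequentially" and lim: "\<And>A. (?a A \<longlongrightarrow> p A) G"
    using convergent_subfilter_of_compact_valued_family[of "\<lambda>_. {0..1::real}" ?a,
        OF compact_Icc orbit_average_indicator_bounds] by blast
  note inX = funpow_in_invariant_set[OF TX x]
  note uniq = tendsto_unique[OF G(1)]
  have add: "?a (A \<union> B) n + ?a (A \<inter> B) n = ?a A n + ?a B n" for A B n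
  proof -
    have "(\<Sum>k=1..n. indicat_real (A \<union> B) ((T ^^ k) x)) + (\<Sum>k=1..n. indicat_real (A \<inter> B) ((T ^^ k) x))
        = (\<Sum>k=1..n. indicat_real A ((T ^^ k) x)) + (\<Sum>k=1..n. indicat_real B ((T ^^ k) x))"
      unfolding sum.distrib[symmetric] by (rule sum.cong) (auto split: split_indicator)
    then show ?thesis
      unfolding orbit_average_def distrib_left[symmetric] by simp
  qed
  have nonneg: "0 \<le> p A" for A
    by (intro tendsto_lowerbound[OF lim _ G(1)] always_eventually) (simp add: orbit_average_def sum_nonneg)
  have padd: "p (A \<union> B) + p (A \<inter> B) = p A + p B" for A B
    by (rule uniq[OF _ tendsto_add[OF lim[of A] lim[of B]]]) (use tendsto_add[OF lim[of "A \<union> B"] lim[of "A \<inter> B"]] add in simp)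
  have p0: "p {} = 0"
    by (rule uniq[OF lim]) (simp add: orbit_average_def)
  have p1: "p X = 1"
  proof (rule uniq[OF lim], rule tendsto_eventually, rule filter_leD[OF G(2)])
    show "\<forall>\<^sub>F n in sequentially. ?a X n = 1"
      using eventually_gt_at_top[of 0] by eventually_elim (simp add: orbit_average_def inX)
  qed
  have pX: "p (X \<inter> A) = p A" for A
    by (rule uniq[OF lim]) (use lim[of A] inX in \<open>simp add: orbit_average_def indicator_def\<close>)
  have pT: "p (T -` A) = p A" for A
  proof -
    have "(\<lambda>n. orbit_average T (indicat_real A) n (T x) - ?a A n) \<longlonglongrightarrow> 0"
      by (rule orbit_average_image_diff_tendsto_0[where B=1]) (simp add: indicator_def)
    then have "((\<lambda>n. orbit_average T (indicat_real A) n (T x) - ?a A n) \<longlongrightarrow> 0) G"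
      using G(2) by (rule tendsto_mono[rotated])
    moreover have "orbit_average T (indicat_real A) n (T x) = ?a (T -` A) n" for n
      by (simp add: orbit_average_def indicator_def funpow_swap1)
    ultimately have "((\<lambda>n. ?a (T -` A) n - ?a A n) \<longlongrightarrow> 0) G" by simp
    from uniq[OF this tendsto_diff[OF lim lim]] show ?thesis by simp
  qed
  have pdisj: "p (A \<union> B) = p A + p B" if "A \<inter> B = {}" for A B
    using padd[of A B] p0 that by simp
  show thesis
  proof (rule that[of p])
    show "p A \<le> p B" if "A \<subseteq> B" for A B
      using pdisj[of A "B - A"] nonneg[of "B - A"] that by (simp add: Un_absorb1)
    show "p (A \<union> B) \<le> p A + p B" for A B
      using padd[of A B] nonneg[of "A \<inter> B"] by linarith
  qed (use nonneg p0 p1 pX pT pdisj in auto)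
qed

text \<open>
  The measure induced by the invariant mean is invariant although it need not agree with the mean on compact sets: a
  compact set in the preimage of \<open>U\<close> has a compact image in \<open>U\<close>, and the preimage of a compact set in \<open>U\<close> is compact.
  Thus the suprema that define the measures of an open set and of its preimage coincide, and open sets form an
  intersection-stable generator.
\<close>

lemma invariant_measures_nonempty:
  fixes X :: "'a::metric_space set"
  assumes tds: "tds X T"
  shows "invariant_measures X T \<noteq> {}"
proof -
  from tds obtain x where x: "x \<in> X" and TX: "T \<in> X \<rightarrow> X" and X: "compact X" and cont: "continuous_on X T"
    by (auto simp: tds_def)
  obtain p :: "'a set \<Rightarrow> real" where p0: "\<And>A. 0 \<le> p A" and pe: "p {} = 0" and p1: "p X = 1"
    and pmono: "\<And>A B. A \<subseteq> B \<Longrightarrow> p A \<le> p B"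
    and psub: "\<And>A B. p (A \<union> B) \<le> p A + p B"
    and padd: "\<And>A B. A \<inter> B = {} \<Longrightarrow> p (A \<union> B) = p A + p B"
    and pX: "\<And>A. p (X \<inter> A) = p A" and pT: "\<And>A. p (T -` A) = p A"
    using exists_invariant_mean[OF TX x] by blast
  define m where "m A = ennreal (p A)" for A
  interpret compact_content m
    by unfold_locales
      (auto simp: m_def pe p0 padd ennreal_leI pmono simp flip: ennreal_plus intro: psub)
  obtain M where sM: "sets M = sets borel" and oM: "\<And>U. open U \<Longrightarrow> emeasure M U = inner_content m U"
    and rM: "\<And>A. A \<in> sets borel \<Longrightarrow> emeasure M A = (INF U\<in>{U. open U \<and> A \<subseteq> U}. inner_content m U)"
    using content_induces_measure by blast
  have spM: "space M = UNIV" using sets_eq_imp_space_eq[OF sM] by simp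
  have "closed X" using X by (rule compact_imp_closed)
  then have XM: "X \<in> sets M" "- X \<in> sets M" by (auto simp: sM)
  have "emeasure M (- X) = 0"
  proof -
    have "m K \<le> 0" if "K \<subseteq> - X" for K
    proof -
      have "X \<inter> K = {}" using that by blast
      with pX[of K] pe show ?thesis by (simp add: m_def)
    qed
    then have "inner_content m (- X) \<le> 0"
      unfolding inner_content_def by (intro SUP_least) auto
    then show ?thesis
      using \<open>closed X\<close> by (simp add: oM open_Compl)
  qed
  then have MX: "emeasure M (A \<inter> X) = emeasure M A" if "A \<in> sets M" for A
    using that XM by (intro emeasure_eq_AE) (auto intro!: AE_I'[of "- X"] simp: null_sets_def)
  have "inner_content m U = 1" if "X \<subseteq> U" for U
  proof (rule antisym)
    show "inner_content m U \<le> 1"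
      unfolding inner_content_def m_def using pmono[of "X \<inter> _" X] p1 pX
      by (intro SUP_least) (metis Int_lower1 ennreal_le_1)
    show "1 \<le> inner_content m U"
      using content_le_inner_content[OF X that, of m] by (simp add: m_def p1)
  qed
  then have "emeasure M X = (INF U\<in>{U. open U \<and> X \<subseteq> U}. 1)"
    using XM sM by (subst rM) (auto intro!: INF_cong)
  also have "\<dots> = 1" by (rule INF_const) auto
  finally have M1: "emeasure M X = 1" .
  define \<mu> where "\<mu> = restrict_space M X"
  have s\<mu>: "sets \<mu> = sets (restrict_space borel X)"
    unfolding \<mu>_def by (rule sets_restrict_space_cong[OF sM])
  have sp\<mu>: "space \<mu> = X" by (simp add: \<mu>_def space_restrict_space spM)
  have e\<mu>: "emeasure \<mu> A = emeasure M A" if "A \<subseteq> X" for A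
    unfolding \<mu>_def using that XM by (intro emeasure_restrict_space) (auto simp: spM)
  have "prob_space \<mu>"
    by (rule prob_spaceI) (simp add: sp\<mu> e\<mu> M1)
  interpret prob_space \<mu> by fact
  have T: "T \<in> measurable \<mu> \<mu>"
    by (rule tds_map_measurable[OF tds s\<mu>])
  have "distr \<mu> \<mu> T = \<mu>"
  proof (rule measure_eqI_generator_eq[where E="{X \<inter> U | U. open U}" and \<Omega>=X and A="\<lambda>_. X"])
    show "Int_stable {X \<inter> U | U. open U}"
    proof (intro Int_stableI, clarify)
      fix U V :: "'a set" assume "open U" "open V"
      then have "(X \<inter> U) \<inter> (X \<inter> V) = X \<inter> (U \<inter> V) \<and> open (U \<inter> V)" by auto
      then show "\<exists>W. (X \<inter> U) \<inter> (X \<inter> V) = X \<inter> W \<and> open W" by blast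
    qed
    show gen: "sets \<mu> = sigma_sets X {X \<inter> U | U. open U}"
    proof -
      have "sets \<mu> = (\<inter>) X ` sigma_sets UNIV {S. open S}"
        by (simp add: s\<mu> sets_restrict_space borel_def)
      also have "\<dots> = sigma_sets X ((\<inter>) X ` {S. open S})"
        using \<open>closed X\<close> by (intro sigma_sets_Int) (auto simp flip: borel_def sets_borel)
      also have "(\<inter>) X ` {S. open S} = {X \<inter> U | U. open U}" by blast
      finally show ?thesis .
    qed
    then show "sets (distr \<mu> \<mu> T) = sigma_sets X {X \<inter> U | U. open U}" by simp
    fix A assume "A \<in> {X \<inter> U | U. open U}"
    then obtain U where U: "open U" "A = X \<inter> U" by blast
    from continuous_openin_preimage_gen[OF cont U(1)]
    obtain W where W: "open W" "X \<inter> T -` U = X \<inter> W"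
      by (auto simp: openin_open)
    \<comment> \<open>The preimage of \<open>U\<close> is open only relative to \<open>X\<close>, and \<open>inner_content\<close> needs the ambient open set \<open>W\<close> with this trace on \<open>X\<close>.\<close>
    have "inner_content m W = inner_content m U"
    proof (rule antisym)
      show "inner_content m W \<le> inner_content m U"
        unfolding inner_content_def[of _ W]
      proof (intro SUP_least, elim CollectE conjE)
        fix K assume K: "compact K" "K \<subseteq> W"
        have "p K = p (X \<inter> K)" by (simp add: pX)
        also have "\<dots> \<le> p (T -` (T ` (X \<inter> K)))" by (rule pmono) blast
        finally have "m K \<le> m (T ` (X \<inter> K))" by (simp add: pT m_def ennreal_leI)
        also have "\<dots> \<le> inner_content m U"
        proof (rule content_le_inner_content)
          show "compact (T ` (X \<inter> K))"
            using K X cont by (intro compact_continuous_image) (auto intro: continuous_on_subset)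
          show "T ` (X \<inter> K) \<subseteq> U" using K W by blast
        qed
        finally show "m K \<le> inner_content m U" .
      qed
      show "inner_content m U \<le> inner_content m W"
        unfolding inner_content_def[of _ U]
      proof (intro SUP_least, elim CollectE conjE)
        fix K assume K: "compact K" "K \<subseteq> U"
        have "m K = m (X \<inter> T -` K)" by (simp add: m_def pX pT)
        also have "\<dots> \<le> inner_content m W"
        proof (rule content_le_inner_content)
          have "closed (X \<inter> T -` K)"
            using continuous_closed_preimage[OF cont \<open>closed X\<close>] K compact_imp_closed by blast
          then show "compact (X \<inter> T -` K)"
            using X by (metis compact_Int_closed inf.left_idem)
          show "X \<inter> T -` K \<subseteq> W" using K W by blast
        qed
        finally show "m K \<le> inner_content m W" .
      qed
    qed
    moreover have "A \<in> sets \<mu>" using U by (auto simp: s\<mu> sets_restrict_space)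
    moreover have "T -` A \<inter> X = X \<inter> W" using W U TX by auto
    ultimately show "emeasure (distr \<mu> \<mu> T) A = emeasure \<mu> A"
      using U W MX[of U] MX[of W] sM oM by (simp add: emeasure_distr[OF T] sp\<mu> e\<mu> Int_commute)
  next
    show "emeasure (distr \<mu> \<mu> T) X \<noteq> \<infinity>" for i :: nat
      using prob_space.emeasure_space_1[OF prob_space_distr[OF T]] by (simp add: sp\<mu>)
  qed (auto intro: exI[of _ UNIV])
  then show ?thesis
    using s\<mu> \<open>prob_space \<mu>\<close> by (auto simp: invariant_measures_def)
qed

section \<open>Minimality and full support\<close>

theorem lemma3p11:
  fixes X :: "'a::metric_space set" and T :: "'a \<Rightarrow> 'a"
  assumes "tds X T"
    and "transitive_tds X T"
    and "weakly_mean_equicontinuous X T"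
  shows "minimal_tds X T \<longleftrightarrow> tds_support X T = X"
  using full_support_if_minimal[OF assms(1) _ invariant_measures_nonempty[OF assms(1)]]
    minimal_if_full_support[OF assms]
  by blast

end
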